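(* Let $n\ge m\ge 1$ and $r=n-m+1$. The total number of occurrences of the subword $1^m$ within all the members of $NC_n$, i.e. $\sum_{\pi\in NC_n}\mu_{1^m}(\pi)$, equals $\binom{2r}{r+1}$, and the total number of occurrences of the subword $1^m2$, i.e. $\sum_{\pi\in NC_n}\mu_{1^m2}(\pi)$, equals $\binom{2r-1}{r+1}$.
   Context: A set partition of $[n]=\{1,\dots,n\}$ with blocks $B_1,\dots,B_k$ ordered so that $\min B_1<\cdots<\min B_k$ is represented by its canonical sequential form $\pi=\pi_1\cdots\pi_n$, where $i\in B_{\pi_i}$ for each $i$. It is non-crossing if $\pi$ contains no (not necessarily consecutive) subsequence of the form $a\,b\,a\,b$ with $a<b$. $NC_n$ denotes the set of non-crossing partitions of $[n]$, identified with their canonical sequential forms. A subword pattern is a finite sequence $\tau=\tau_1\cdots\tau_k$ of positive integers whose set of distinct letters is $[\ell]$ for some $\ell$. An occurrence of $\tau$ in a sequence $\rho_1\cdots\rho_n$ is an index $i\in[n-k+1]$ such that the string of consecutive letters $\rho_i\cdots\rho_{i+k-1}$ is order-isomorphic to $\tau$ (same relative order, including equalities). $\mu_\tau(\pi)$ denotes the number of occurrences of $\tau$ in $\pi$. $1^m$ is the word of $m$ ones, and $1^m2$ is $m$ ones followed by a $2$. *)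

theory Defs
  imports Complex_Main "HOL-Library.Disjoint_Sets"
begin

definition block_of :: "nat set set \<Rightarrow> nat \<Rightarrow> nat set" where
  "block_of P i = (THE B. B \<in> P \<and> i \<in> B)"

(* The rank of B among the blocks of P ordered by their minima: with
   P = {B_1, ..., B_k} and Min B_1 < ... < Min B_k, the index of B_j is j
   (see block_index_ordered below). *)
definition block_index :: "nat set set \<Rightarrow> nat set \<Rightarrow> nat" where
  "block_index P B = card {C \<in> P. Min C \<le> Min B}"

(* The letter pi_i is stored at list position i - 1. *)
definition canonical_form :: "nat \<Rightarrow> nat set set \<Rightarrow> nat list" where
  "canonical_form n P = map (\<lambda>i. block_index P (block_of P i)) [1..<Suc n]"

definition noncrossing :: "nat list \<Rightarrow> bool" where
  "noncrossing w \<longleftrightarrow>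
     \<not> (\<exists>i j k l. i < j \<and> j < k \<and> k < l \<and> l < length w \<and>
          w ! i = w ! k \<and> w ! j = w ! l \<and> w ! i < w ! j)"

definition NC :: "nat \<Rightarrow> nat set set set" where
  "NC n = {P. partition_on {1..n} P \<and> noncrossing (canonical_form n P)}"

definition order_isomorphic :: "nat list \<Rightarrow> nat list \<Rightarrow> bool" where
  "order_isomorphic u v \<longleftrightarrow> length u = length v \<and>
     (\<forall>i < length u. \<forall>j < length u.
        (u ! i < u ! j \<longleftrightarrow> v ! i < v ! j) \<and> (u ! i = u ! j \<longleftrightarrow> v ! i = v ! j))"

(* Positions are counted from 0; there are none if the pattern is longer than the word. *)
definition occurrences :: "nat list \<Rightarrow> nat list \<Rightarrow> nat" where
  "occurrences \<tau> \<rho> = card {i. i + length \<tau> \<le> length \<rho> \<and>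
     order_isomorphic (take (length \<tau>) (drop i \<rho>)) \<tau>}"

lemma block_index_ordered:
  fixes B :: "nat \<Rightarrow> nat set"
  assumes P: "P = B ` {1..k}"
    and mono: "\<And>i j. 1 \<le> i \<Longrightarrow> i < j \<Longrightarrow> j \<le> k \<Longrightarrow> Min (B i) < Min (B j)"
    and j: "1 \<le> j" "j \<le> k"
  shows "block_index P (B j) = j"
proof -
  have le_iff: "Min (B i) \<le> Min (B j) \<longleftrightarrow> i \<le> j" if "1 \<le> i" "i \<le> k" for i
    using that j mono[of i j] mono[of j i] by (cases i j rule: linorder_cases) auto
  have eq: "{C \<in> P. Min C \<le> Min (B j)} = B ` {1..j}"
    using le_iff j unfolding P by force
  have "inj_on B {1..j}"
  proof (rule linorder_inj_onI')
    fix i i' assume "i \<in> {1..j}" "i' \<in> {1..j}" "i < i'"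
    then show "B i \<noteq> B i'" using mono[of i i'] j by auto
  qed
  then show ?thesis
    unfolding block_index_def eq by (simp add: card_image)
qed

lemma block_of_eq:
  assumes "partition_on A P" "B \<in> P" "i \<in> B"
  shows "block_of P i = B"
  unfolding block_of_def
proof (rule the_equality)
  fix C assume "C \<in> P \<and> i \<in> C"
  then show "C = B"
    using assms disjointD[OF partition_onD2[OF assms(1)], of C B] by blast
qed (use assms in simp)

end

theory Submission imports Defs
begin

text \<open>
  Contracting the run at an occurrence of \<open>1^m\<close> in position \<open>i\<close> is a bijection onto \<open>NC_r\<close>, so the
  first total is \<open>r |NC_r|\<close>; likewise the second total is the number of ascents in the members of
  \<open>NC_r\<close>. By non-crossing-ness an ascent always leads to a letter that was not used before, so
  a member of \<open>NC_r\<close> with \<open>b\<close> blocks has \<open>b - 1\<close> ascents.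

  Both \<open>|NC_r|\<close> and the total number of blocks follow from appending letters one at a time. Call an
  old letter open if appending it creates no crossing. If a word has \<open>h\<close> open letters, then it has
  \<open>h + 1\<close> continuations, and these have \<open>1, ..., h + 1\<close> open letters. The resulting recurrences
  are solved by \<open>C(2n-k-1, n-k) - C(2n-k-1, n)\<close> for the number of words of length \<open>n\<close> with \<open>k\<close>
  open letters, and by \<open>k C(2n-k-2, n-k)\<close> for the total number of their blocks.
\<close>

section \<open>Restricted growth words, the canonical forms of set partitions, and their
  letters\<close>

definition rgf :: "nat list \<Rightarrow> bool" where
  "rgf w \<longleftrightarrow> (\<forall>i < length w. 1 \<le> w ! i \<and> (\<forall>x. 1 \<le> x \<and> x < w ! i \<longrightarrow> (\<exists>j < i. w ! j = x)))"

definition nc_words :: "nat \<Rightarrow> nat list set" where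
  "nc_words n = {w. length w = n \<and> rgf w \<and> noncrossing w}"

text \<open>In a word of \<open>nc_words\<close>, a letter \<open>y\<close> smaller than
  \<open>x\<close> and standing after an occurrence of \<open>x\<close> also stands before it by
  restricted growth, so appending \<open>x\<close> would complete the crossing
  \<open>y x y x\<close>. The open letters are those used letters \<open>x\<close> that have no such
  \<open>y\<close> after them.\<close>

definition open_letters :: "nat list \<Rightarrow> nat set" where
  "open_letters w = {w ! i | i. i < length w \<and> (\<forall>j. i \<le> j \<and> j < length w \<longrightarrow> w ! i \<le> w ! j)}"

definition next_letters :: "nat list \<Rightarrow> nat set" where
  "next_letters w = insert (Suc (card (set w))) (open_letters w)"

definition ascents :: "nat list \<Rightarrow> nat" where
  "ascents w = card {i. Suc i < length w \<and> w ! i < w ! Suc i}"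

text \<open>Serves twice: with the identity it ranks the continuations of a word, with
  \<open>Min\<close> it numbers the blocks of a partition. The rank is strictly monotone in
  \<open>f\<close>, hence injective, and its range has only \<open>card A\<close>
  candidates.\<close>

lemma bij_betw_rank:
  fixes f :: "'a \<Rightarrow> 'b::linorder"
  assumes fin: "finite A" and inj: "inj_on f A"
  shows "bij_betw (\<lambda>a. card {b \<in> A. f b \<le> f a}) A {1..card A}"
proof -
  let ?g = "\<lambda>a. card {b \<in> A. f b \<le> f a}"
  have mono: "?g a < ?g b" if "a \<in> A" "b \<in> A" "f a < f b" for a b
  proof (rule psubset_card_mono)
    have "b \<notin> {c \<in> A. f c \<le> f a}" "b \<in> {c \<in> A. f c \<le> f b}" using that by auto
    then show "{c \<in> A. f c \<le> f a} \<subset> {c \<in> A. f c \<le> f b}" using that by force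
  qed (use fin in simp)
  have injg: "inj_on ?g A"
  proof (rule inj_onI)
    fix a b assume "a \<in> A" "b \<in> A" "?g a = ?g b"
    then have "f a = f b"
      using mono[of a b] mono[of b a] by (cases "f a" "f b" rule: linorder_cases) auto
    then show "a = b" using inj \<open>a \<in> A\<close> \<open>b \<in> A\<close> by (auto dest: inj_onD)
  qed
  have "1 \<le> ?g a" if "a \<in> A" for a
  proof -
    have "a \<in> {b \<in> A. f b \<le> f a}" using that by simp
    then have "0 < ?g a" using fin by (subst card_gt_0_iff) auto
    then show ?thesis by simp
  qed
  moreover have "?g a \<le> card A" for a by (rule card_mono) (use fin in auto)
  ultimately have "?g ` A \<subseteq> {1..card A}" by auto
  then have "?g ` A = {1..card A}"
    by (intro card_subset_eq) (use injg in \<open>auto simp: card_image\<close>)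
  then show ?thesis using injg by (simp add: bij_betw_def)
qed

lemma rgf_append:
  "rgf (w @ [a]) \<longleftrightarrow> rgf w \<and> 1 \<le> a \<and> {1..<a} \<subseteq> set w"
proof -
  have before: "(\<exists>j<i. (w @ [a]) ! j = x) \<longleftrightarrow> (\<exists>j<i. w ! j = x)" if "i \<le> length w" for i x
    by (rule ex_cong1, rule conj_cong) (use that in \<open>simp_all add: nth_append\<close>)
  define Q where "Q u i \<longleftrightarrow> 1 \<le> u ! i \<and> (\<forall>x. 1 \<le> x \<and> x < u ! i \<longrightarrow> (\<exists>j<i. u ! j = x))"
    for u :: "nat list" and i
  have old: "Q (w @ [a]) i \<longleftrightarrow> Q w i" if "i < length w" for i
  proof -
    have "(w @ [a]) ! i = w ! i" using that by (simp add: nth_append)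
    then show ?thesis unfolding Q_def before[OF less_imp_le[OF that]] by simp
  qed
  have new: "Q (w @ [a]) (length w) \<longleftrightarrow> 1 \<le> a \<and> (\<forall>x. 1 \<le> x \<and> x < a \<longrightarrow> x \<in> set w)"
    unfolding Q_def by (simp add: before in_set_conv_nth)
  have "rgf u \<longleftrightarrow> (\<forall>i<length u. Q u i)" for u
    unfolding rgf_def Q_def ..
  then have "rgf (w @ [a]) \<longleftrightarrow> rgf w \<and> 1 \<le> a \<and> (\<forall>x. 1 \<le> x \<and> x < a \<longrightarrow> x \<in> set w)"
    using old new by (auto simp: less_Suc_eq)
  then show ?thesis by (auto simp: subset_iff)
qed

text \<open>A new letter exceeds the maximum so far by at most one, so no value is ever
  skipped.\<close>

lemma set_rgf: "rgf w \<Longrightarrow> set w = {1..card (set w)}"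
proof (induction w rule: rev_induct)
  case (snoc a w)
  then have IH: "set w = {1..card (set w)}" and a: "1 \<le> a" "{1..<a} \<subseteq> set w"
    by (auto simp: rgf_append)
  define k where "k = card (set w)"
  have wk: "set w = {1..k}" using IH unfolding k_def[symmetric] .
  have a': "a \<le> Suc k"
  proof (rule ccontr)
    assume "\<not> a \<le> Suc k"
    then have "Suc k \<in> set w" using a by auto
    then show False using wk by auto
  qed
  have "set (w @ [a]) = {1..max a k}"
    using wk a a' by auto
  then show ?case by simp
qed simp

lemma mem_set_rgf_iff: "rgf w \<Longrightarrow> x \<in> set w \<longleftrightarrow> 1 \<le> x \<and> x \<le> card (set w)"
  by (subst set_rgf) auto

lemma finite_nc_words: "finite (nc_words n)"
proof (rule finite_subset)
  show "nc_words n \<subseteq> {w. set w \<subseteq> {1..n} \<and> length w = n}"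
  proof
    fix w assume "w \<in> nc_words n"
    then have "rgf w" "length w = n" by (auto simp: nc_words_def)
    then show "w \<in> {w. set w \<subseteq> {1..n} \<and> length w = n}"
      using mem_set_rgf_iff[of w] card_length[of w] by fastforce
  qed
qed (simp add: finite_lists_length_eq)

section \<open>Open letters and the admissible continuations of a word\<close>

lemma open_letters_subset: "open_letters w \<subseteq> set w"
  unfolding open_letters_def by auto

lemma mem_open_letters_iff:
  "x \<in> open_letters w \<longleftrightarrow>
     (\<exists>i < length w. w ! i = x \<and> (\<forall>j < length w. i \<le> j \<longrightarrow> x \<le> w ! j))"
  unfolding open_letters_def by blast

lemma finite_open_letters: "finite (open_letters w)"
  using open_letters_subset finite_subset by blast

lemma next_letter_unused_iff:
  assumes "rgf w" "a \<in> next_letters w"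
  shows "a \<notin> set w \<longleftrightarrow> a = Suc (card (set w))"
proof -
  have "Suc (card (set w)) \<notin> set w" using mem_set_rgf_iff[OF assms(1)] by simp
  then show ?thesis using assms(2) open_letters_subset[of w] by (auto simp: next_letters_def)
qed

text \<open>A crossing that is not already in \<open>w\<close> must use the new position as its
  fourth one, so only the first three positions remain to be excluded in \<open>w\<close>.\<close>

lemma noncrossing_append:
  "noncrossing (w @ [a]) \<longleftrightarrow> noncrossing w \<and>
     \<not> (\<exists>i j k. i < j \<and> j < k \<and> k < length w \<and> w ! i = w ! k \<and> w ! j = a \<and> w ! i < a)"
    (is "?L \<longleftrightarrow> ?R")
proof
  assume L: ?L
  have "False" if "i < j" "j < k" "k < l" "l < length w" "w ! i = w ! k" "w ! j = w ! l" "w ! i < w ! j"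
    for i j k l
  proof -
    have "(w @ [a]) ! p = w ! p" if "p \<in> {i, j, k, l}" for p
      using that \<open>i < j\<close> \<open>j < k\<close> \<open>k < l\<close> \<open>l < length w\<close> by (auto simp: nth_append)
    moreover have "l < length (w @ [a])" using that by simp
    ultimately show False using L that unfolding noncrossing_def by (metis insertI1 insertI2)
  qed
  then have "noncrossing w" unfolding noncrossing_def by blast
  moreover have "False" if "i < j" "j < k" "k < length w" "w ! i = w ! k" "w ! j = a" "w ! i < a" for i j k
  proof -
    have "(w @ [a]) ! p = w ! p" if "p \<in> {i, j, k}" for p
      using that \<open>i < j\<close> \<open>j < k\<close> \<open>k < length w\<close> by (auto simp: nth_append)
    moreover have "(w @ [a]) ! length w = a" "length w < length (w @ [a])" by simp_all
    ultimately show False using L that unfolding noncrossing_def by (metis insertI1 insertI2)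
  qed
  ultimately show ?R by blast
next
  assume R: ?R
  show ?L
    unfolding noncrossing_def
  proof (intro notI, elim exE conjE)
    fix i j k l
    assume *: "i < j" "j < k" "k < l" "l < length (w @ [a])"
      "(w @ [a]) ! i = (w @ [a]) ! k" "(w @ [a]) ! j = (w @ [a]) ! l" "(w @ [a]) ! i < (w @ [a]) ! j"
    show False
    proof (cases "l = length w")
      case True
      then show False using * R by (auto simp: nth_append)
    next
      case False
      then have "w ! i = w ! k" "w ! j = w ! l" "w ! i < w ! j" "l < length w"
        using * by (auto simp: nth_append split: if_splits)
      then show False using R * unfolding noncrossing_def by blast
    qed
  qed
qed

lemma nc_words_append:
  "w @ [a] \<in> nc_words (Suc n) \<longleftrightarrow> w \<in> nc_words n \<and> a \<in> next_letters w"
proof (cases "length w = n \<and> rgf w \<and> noncrossing w")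
  case False
  then show ?thesis by (auto simp: nc_words_def rgf_append noncrossing_append)
next
  case True
  then have w: "length w = n" "rgf w" "noncrossing w" by auto
  have "rgf (w @ [a]) \<and> noncrossing (w @ [a]) \<longleftrightarrow> a \<in> next_letters w"
  proof
    assume ext: "rgf (w @ [a]) \<and> noncrossing (w @ [a])"
    show "a \<in> next_letters w"
    proof (cases "a \<in> set w")
      case False
      moreover have "card (set (w @ [a])) = Suc (card (set w))" using False by simp
      ultimately have "a = Suc (card (set w))"
        using ext mem_set_rgf_iff[OF w(2), of a] mem_set_rgf_iff[of "w @ [a]" a] by auto
      then show ?thesis by (simp add: next_letters_def)
    next
      case True
      then obtain i where i: "i < length w" "w ! i = a" by (auto simp: in_set_conv_nth)
      have "w ! i \<le> w ! j" if j: "i \<le> j" "j < length w" for j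
      proof (rule ccontr)
        assume less: "\<not> w ! i \<le> w ! j"
        then have "1 \<le> w ! j" "w ! j < w ! i" using w(2) j by (auto simp: rgf_def)
        \<comment> \<open>Restricted growth puts a copy of the smaller letter \<open>w ! j\<close>
          at some \<open>p\<close> before \<open>i\<close>; then \<open>p\<close>, \<open>i\<close>,
          \<open>j\<close> and the appended \<open>a\<close> form a crossing.\<close>
        then obtain p where "p < i" "w ! p = w ! j" using w(2) i unfolding rgf_def by metis
        moreover have "i < j" using j less by (cases "i = j") auto
        ultimately show False
          using ext i j less unfolding noncrossing_append by (metis not_le_imp_less)
      qed
      then show ?thesis using i unfolding next_letters_def open_letters_def by auto
    qed
  next
    assume a: "a \<in> next_letters w"
    show "rgf (w @ [a]) \<and> noncrossing (w @ [a])"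
    proof (cases "a \<in> set w")
      case False
      then have "a = Suc (card (set w))" using next_letter_unused_iff w a by blast
      then have "{1..<a} \<subseteq> set w" "1 \<le> a" by (auto simp: mem_set_rgf_iff[OF w(2)])
      then show ?thesis using w False
        unfolding rgf_append noncrossing_append by (auto dest: nth_mem)
    next
      case True
      then have rgf: "rgf (w @ [a])"
        using w(2) by (auto simp: rgf_append mem_set_rgf_iff[OF w(2)])
      have "a \<noteq> Suc (card (set w))" using next_letter_unused_iff[OF w(2) a] True by blast
      then obtain i where i: "i < length w" "w ! i = a" "\<And>j. i \<le> j \<Longrightarrow> j < length w \<Longrightarrow> a \<le> w ! j"
        using a unfolding next_letters_def open_letters_def by auto
      \<comment> \<open>If \<open>i \<le> k\<close>, then \<open>w ! k < a\<close> contradicts the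
        choice of \<open>i\<close>. If \<open>k < i\<close>, then \<open>p\<close>,
        \<open>j\<close>, \<open>k\<close>, \<open>i\<close> already form a crossing in
        \<open>w\<close>, because \<open>w ! i = a\<close>.\<close>
      have False if p: "p < j" "j < k" "k < length w" "w ! p = w ! k" "w ! j = a" "w ! p < a" for p j k
      proof (cases "i \<le> k")
        case True
        then show False using i(3)[of k] p by auto
      next
        case False
        then show False using p i w(3) unfolding noncrossing_def by (metis not_le_imp_less)
      qed
      then show ?thesis using w rgf unfolding noncrossing_append by blast
    qed
  qed
  then show ?thesis using w by (auto simp: nc_words_def)
qed

text \<open>The last letter is always open, and an open letter remains so unless it exceeds the new
  last letter. Phrased with \<open>next_letters\<close>, one formula covers old and new
  \<open>a\<close> alike and turns the number of open letters into a rank.\<close>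

lemma open_letters_append:
  assumes "rgf w" "a \<in> next_letters w"
  shows "open_letters (w @ [a]) = {b \<in> next_letters w. b \<le> a}"
proof -
  have "open_letters (w @ [a]) = insert a {b \<in> open_letters w. b \<le> a}"
    by (rule set_eqI)
       (auto simp: mem_open_letters_iff nth_append Ex_less_Suc All_less_Suc cong: conj_cong)
  also have "\<dots> = {b \<in> next_letters w. b \<le> a}"
  proof -
    have "b \<le> card (set w)" if "b \<in> open_letters w" for b
      using that open_letters_subset[of w] mem_set_rgf_iff[OF assms(1)] by blast
    then show ?thesis using assms(2) by (fastforce simp: next_letters_def)
  qed
  finally show ?thesis .
qed

section \<open>The succession rule for the number of open letters\<close>

lemma card_next_letters:
  assumes "rgf w"
  shows "card (next_letters w) = Suc (card (open_letters w))"
proof -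
  have "Suc (card (set w)) \<notin> open_letters w"
    using open_letters_subset[of w] mem_set_rgf_iff[OF assms] by fastforce
  then show ?thesis by (simp add: next_letters_def finite_open_letters)
qed

text \<open>By \<open>open_letters_append\<close> the number of open letters after appending
  \<open>a\<close> is the rank of \<open>a\<close> in \<open>next_letters w\<close>. This is the
  succession rule of the Catalan generating tree.\<close>

lemma bij_betw_next_letters:
  assumes "rgf w"
  shows "bij_betw (\<lambda>a. card (open_letters (w @ [a]))) (next_letters w) {1..Suc (card (open_letters w))}"
proof -
  have "bij_betw (\<lambda>a. card {b \<in> next_letters w. b \<le> a}) (next_letters w) {1..card (next_letters w)}"
    using bij_betw_rank[of "next_letters w" "\<lambda>x. x"] finite_open_letters
    by (simp add: next_letters_def)
  then show ?thesis
    by (subst bij_betw_cong[where g = "\<lambda>a. card {b \<in> next_letters w. b \<le> a}"])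
       (simp_all add: open_letters_append[OF assms] card_next_letters[OF assms])
qed

text \<open>By the succession rule a word has exactly one continuation with \<open>Suc k\<close>
  open letters if it has at least \<open>k\<close> of them, and none otherwise. The weight
  \<open>f\<close> lets the same bijection serve for counting words (\<open>f\<close> constant) and
  for counting blocks (\<open>f\<close> the identity).\<close>

lemma sum_nc_words_Suc:
  fixes f :: "nat \<Rightarrow> 'a::comm_monoid_add"
  shows "(\<Sum>u | u \<in> nc_words (Suc n) \<and> card (open_letters u) = Suc k. f (card (set u))) =
    (\<Sum>w | w \<in> nc_words n \<and> k \<le> card (open_letters w).
       f (if k = card (open_letters w) then Suc (card (set w)) else card (set w)))"
proof (rule sum.reindex_bij_witness[where
    i = "\<lambda>w. w @ [THE a. a \<in> next_letters w \<and> card (open_letters (w @ [a])) = Suc k]" and j = butlast])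
  have uniq: "\<exists>!a. a \<in> next_letters w \<and> card (open_letters (w @ [a])) = Suc k"
    if w: "rgf w" "k \<le> card (open_letters w)" for w
  proof -
    let ?r = "\<lambda>a. card (open_letters (w @ [a]))"
    note bij = bij_betw_next_letters[OF w(1)]
    have "Suc k \<in> ?r ` next_letters w"
      unfolding bij_betw_imp_surj_on[OF bij] using w by simp
    then obtain a where a: "Suc k = ?r a" "a \<in> next_letters w" by (rule imageE)
    have "b = a" if "b \<in> next_letters w" "?r b = Suc k" for b
      by (rule inj_onD[OF bij_betw_imp_inj_on[OF bij]]) (use a that in simp_all)
    then show ?thesis using a by (intro ex1I[of _ a]) auto
  qed
  let ?a = "\<lambda>w. THE a. a \<in> next_letters w \<and> card (open_letters (w @ [a])) = Suc k"
  fix w assume w: "w \<in> {w. w \<in> nc_words n \<and> k \<le> card (open_letters w)}"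
  then have "rgf w" by (simp add: nc_words_def)
  have "?a w \<in> next_letters w \<and> card (open_letters (w @ [?a w])) = Suc k"
    by (rule theI'[OF uniq[OF \<open>rgf w\<close>]]) (use w in simp)
  then show "butlast (w @ [?a w]) = w" "w @ [?a w] \<in> {u. u \<in> nc_words (Suc n) \<and> card (open_letters u) = Suc k}"
    using w by (auto simp: nc_words_append)
next
  let ?a = "\<lambda>w. THE a. a \<in> next_letters w \<and> card (open_letters (w @ [a])) = Suc k"
  fix u assume "u \<in> {u. u \<in> nc_words (Suc n) \<and> card (open_letters u) = Suc k}"
  then have u: "u \<in> nc_words (Suc n)" "card (open_letters u) = Suc k" by auto
  then have "u \<noteq> []" by (auto simp: nc_words_def)
  then obtain w a where ua: "u = w @ [a]" by (metis append_butlast_last_id)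
  then have w: "w \<in> nc_words n" and a: "a \<in> next_letters w" using u nc_words_append by auto
  have "rgf w" using w by (simp add: nc_words_def)
  note bij = bij_betw_next_letters[OF \<open>rgf w\<close>]
  have le: "k \<le> card (open_letters w)"
    using bij_betw_apply[OF bij a] u ua by simp
  then show "butlast u \<in> {w. w \<in> nc_words n \<and> k \<le> card (open_letters w)}" using ua w by simp
  have "?a w = a"
  proof (rule the_equality)
    fix b assume "b \<in> next_letters w \<and> card (open_letters (w @ [b])) = Suc k"
    then show "b = a"
      using inj_on_eq_iff[OF bij_betw_imp_inj_on[OF bij], of b a] a u ua by simp
  qed (use a u ua in simp)
  then show "butlast u @ [?a (butlast u)] = u" using ua by simp
  have new: "a \<notin> set w \<longleftrightarrow> k = card (open_letters w)"
  proof -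
    let ?z = "Suc (card (set w))"
    have z: "?z \<in> next_letters w" by (simp add: next_letters_def)
    have "open_letters (w @ [?z]) = next_letters w"
      using open_letters_append[OF \<open>rgf w\<close> z] open_letters_subset[of w] mem_set_rgf_iff[OF \<open>rgf w\<close>]
      by (fastforce simp: next_letters_def)
    then have "card (open_letters (w @ [?z])) = Suc (card (open_letters w))"
      by (simp add: card_next_letters[OF \<open>rgf w\<close>])
    then have "a = ?z \<longleftrightarrow> k = card (open_letters w)"
      using inj_on_eq_iff[OF bij_betw_imp_inj_on[OF bij] a z] u ua by auto
    then show ?thesis using next_letter_unused_iff[OF \<open>rgf w\<close> a] by simp
  qed
  then show "f (if k = card (open_letters (butlast u)) then Suc (card (set (butlast u)))
      else card (set (butlast u))) = f (card (set u))"
    using ua by (auto simp: insert_absorb)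
qed

text \<open>The last letter of a nonempty word is open, as nothing follows it. This provides the
  zero boundary values at \<open>k = 0\<close>.\<close>

lemma open_letters_eq_empty_iff: "open_letters w = {} \<longleftrightarrow> w = []"
proof
  assume "open_letters w = {}"
  then show "w = []"
  proof (rule contrapos_pp)
    assume "w \<noteq> []"
    have "last w \<in> open_letters w"
      unfolding mem_open_letters_iff
    proof (intro exI conjI allI impI)
      show "length w - 1 < length w" "w ! (length w - 1) = last w"
        using \<open>w \<noteq> []\<close> by (simp_all add: last_conv_nth)
      fix j assume "j < length w" "length w - 1 \<le> j"
      then have "j = length w - 1" by simp
      then show "last w \<le> w ! j" using \<open>w \<noteq> []\<close> by (simp add: last_conv_nth)
    qed
    then show "open_letters w \<noteq> {}" by blast
  qed
qed (simp add: open_letters_def)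

section \<open>Recurrences and closed forms for words and blocks by number of open letters\<close>

definition nc_count :: "nat \<Rightarrow> nat \<Rightarrow> nat" where
  "nc_count n k = card {w \<in> nc_words n. card (open_letters w) = k}"

definition nc_blocks :: "nat \<Rightarrow> nat \<Rightarrow> nat" where
  "nc_blocks n k = (\<Sum>w | w \<in> nc_words n \<and> card (open_letters w) = k. card (set w))"

lemma no_nc_words:
  assumes "k > n \<or> n > 0 \<and> k = 0"
  shows "{w \<in> nc_words n. card (open_letters w) = k} = {}"
proof -
  have "card (open_letters w) \<le> n" "n > 0 \<Longrightarrow> card (open_letters w) \<noteq> 0" if "w \<in> nc_words n" for w
  proof -
    have "card (open_letters w) \<le> card (set w)"
      by (simp add: card_mono open_letters_subset)
    also have "\<dots> \<le> length w" by (rule card_length)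
    finally show "card (open_letters w) \<le> n" using that by (simp add: nc_words_def)
    assume "n > 0"
    then show "card (open_letters w) \<noteq> 0"
      using that by (auto simp: finite_open_letters open_letters_eq_empty_iff nc_words_def)
  qed
  then show ?thesis using assms by fastforce
qed

lemma nc_count_eq_0: "k > n \<or> n > 0 \<and> k = 0 \<Longrightarrow> nc_count n k = 0"
  unfolding nc_count_def by (subst no_nc_words) auto

lemma nc_blocks_eq_0: "k > n \<or> n > 0 \<and> k = 0 \<Longrightarrow> nc_blocks n k = 0"
  unfolding nc_blocks_def by (subst no_nc_words) auto

lemma nc_words_0: "nc_words 0 = {[]}"
  by (auto simp: nc_words_def rgf_def noncrossing_def)

lemma nc_count_0_0: "nc_count 0 0 = 1"
proof -
  have "{w \<in> nc_words 0. card (open_letters w) = 0} = {[]}"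
    by (auto simp: nc_words_0 open_letters_def)
  then show ?thesis by (simp add: nc_count_def)
qed

lemma nc_blocks_0_0: "nc_blocks 0 0 = 0"
  unfolding nc_blocks_def by (rule sum.neutral) (auto simp: nc_words_0)

lemma nc_count_Suc_eq_card:
  "nc_count (Suc n) (Suc k) = card {w \<in> nc_words n. k \<le> card (open_letters w)}"
  using sum_nc_words_Suc[of "\<lambda>_. 1 :: nat" n k] by (simp add: nc_count_def)

lemma nc_blocks_Suc_eq_sum:
  "nc_blocks (Suc n) (Suc k) =
    (\<Sum>w | w \<in> nc_words n \<and> k \<le> card (open_letters w).
       if k = card (open_letters w) then Suc (card (set w)) else card (set w))"
  using sum_nc_words_Suc[of "\<lambda>x. x" n k] by (simp add: nc_blocks_def)

lemma nc_words_split: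
  "{w \<in> nc_words n. k \<le> card (open_letters w)} =
     {w \<in> nc_words n. card (open_letters w) = k} \<union> {w \<in> nc_words n. Suc k \<le> card (open_letters w)}"
  by auto

text \<open>Among the parents with at least \<open>k\<close> open letters, those with exactly
  \<open>k\<close> are split off; the others are the parents for \<open>Suc k\<close>. The result is
  a ballot-type recurrence.\<close>

lemma nc_count_Suc:
  "nc_count (Suc n) (Suc k) = nc_count n k + nc_count (Suc n) (Suc (Suc k))"
  unfolding nc_count_Suc_eq_card nc_words_split[of n k]
  by (subst card_Un_disjoint) (auto simp: nc_count_def finite_nc_words)

text \<open>Parents with exactly \<open>k\<close> open letters gain a block, which yields
  \<open>nc_count n k\<close>. In \<open>nc_blocks (Suc n) (Suc (Suc k))\<close> the parents with
  \<open>Suc k\<close> open letters have gained a block too, although they gain none in the sum for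
  \<open>k\<close>; the term on the left compensates for this without subtraction.\<close>

lemma nc_blocks_Suc:
  "nc_blocks (Suc n) (Suc k) + nc_count n (Suc k) =
     nc_blocks n k + nc_count n k + nc_blocks (Suc n) (Suc (Suc k))"
proof -
  let ?h = "\<lambda>w. card (open_letters w)"
  let ?A = "\<lambda>j. {w \<in> nc_words n. ?h w = j}" and ?U = "\<lambda>j. {w \<in> nc_words n. j \<le> ?h w}"
  have step: "nc_blocks (Suc n) (Suc j) = nc_blocks n j + nc_count n j + (\<Sum>w\<in>?U (Suc j). card (set w))" for j
  proof -
    let ?f = "\<lambda>w. if j = ?h w then Suc (card (set w)) else card (set w)"
    have "nc_blocks (Suc n) (Suc j) = sum ?f (?A j \<union> ?U (Suc j))"
      unfolding nc_blocks_Suc_eq_sum nc_words_split[of n j, symmetric] ..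
    also have "\<dots> = sum ?f (?A j) + sum ?f (?U (Suc j))"
      by (rule sum.union_disjoint) (auto simp: finite_nc_words)
    also have "sum ?f (?A j) = (\<Sum>w\<in>?A j. card (set w) + 1)"
      by (rule sum.cong) auto
    also have "\<dots> = nc_blocks n j + nc_count n j"
      unfolding sum.distrib nc_blocks_def nc_count_def by simp
    also have "sum ?f (?U (Suc j)) = (\<Sum>w\<in>?U (Suc j). card (set w))"
      by (rule sum.cong) auto
    finally show ?thesis .
  qed
  have "(\<Sum>w\<in>?U (Suc k). card (set w)) = nc_blocks n (Suc k) + (\<Sum>w\<in>?U (Suc (Suc k)). card (set w))"
    unfolding nc_words_split[of n "Suc k"] nc_blocks_def
    by (rule sum.union_disjoint) (auto simp: finite_nc_words)
  then show ?thesis using step[of k] step[of "Suc k"] by simp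
qed

lemma nc_count_diag: "nc_count n n = 1"
proof (induction n)
  case (Suc n)
  then show ?case using nc_count_Suc[of n n] by (simp add: nc_count_eq_0)
qed (simp add: nc_count_0_0)

text \<open>In the next two lemmas \<open>n = k + 1 + d\<close>, which avoids subtraction; the truncated
  \<open>k + 2 * d - 1\<close> in the second one is harmless, as \<open>0 choose 0 = 1\<close>.\<close>

lemma nc_count_closed_form:
  "nc_count (Suc k + d) (Suc k) + ((k + 2 * d) choose (Suc (k + d))) = (k + 2 * d) choose d"
\<comment> \<open>The recurrence leads from \<open>(d, k)\<close> to \<open>(d, k - 1)\<close> and
  to \<open>(d - 1, k + 1)\<close>. Hence the outer induction keeps \<open>k\<close> arbitrary and
  an inner induction on \<open>k\<close> runs for fixed \<open>d\<close>.\<close>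
proof (induction d arbitrary: k)
  case 0
  then show ?case by (simp add: nc_count_diag)
next
  case (Suc d)
  note outer = Suc.IH
  show ?case
  proof (induction k)
    case 0
    have "nc_count (Suc 0 + Suc d) (Suc 0) = nc_count (Suc (Suc 0) + d) (Suc (Suc 0))"
      using nc_count_Suc[of "Suc d" 0] by (simp add: nc_count_eq_0)
    then show ?case using outer[of "Suc 0"] by simp
  next
    case (Suc k)
    have "nc_count (Suc (Suc k) + Suc d) (Suc (Suc k)) =
        nc_count (Suc k + Suc d) (Suc k) + nc_count (Suc (Suc (Suc k)) + d) (Suc (Suc (Suc k)))"
      using nc_count_Suc[of "Suc k + Suc d" "Suc k"] by simp
    then show ?case using Suc outer[of "Suc (Suc k)"] by simp
  qed
qed

lemma nc_blocks_closed_form: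
  "nc_blocks (Suc k + d) (Suc k) = Suc k * ((k + 2 * d - 1) choose d)"
proof (induction d arbitrary: k)
  case 0
  show ?case
  proof (induction k)
    case 0
    then show ?case
      using nc_blocks_Suc[of 0 0] by (simp add: nc_blocks_0_0 nc_blocks_eq_0 nc_count_eq_0 nc_count_0_0)
  next
    case (Suc k)
    then show ?case
      using nc_blocks_Suc[of "Suc k" "Suc k"] by (simp add: nc_blocks_eq_0 nc_count_eq_0 nc_count_diag)
  qed
next
  case (Suc d)
  note outer = Suc.IH
  show ?case
  proof (induction k)
    case 0
    have "nc_blocks (Suc 0 + Suc d) (Suc 0) + nc_count (Suc 0 + d) (Suc 0) = 2 * ((2 * d) choose d)"
      using nc_blocks_Suc[of "Suc d" 0] outer[of "Suc 0"]
      by (simp add: nc_blocks_eq_0 nc_count_eq_0)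
    \<comment> \<open>Eliminating the count leaves
      \<open>(2 * d choose d) + (2 * d choose Suc d)\<close>, which Pascal's rule combines.\<close>
    then show ?case using nc_count_closed_form[of 0 d] by simp
  next
    case (Suc k)
    \<comment> \<open>\<open>M\<close> is the common top index: the coefficients below have top
      \<open>M\<close>, or \<open>Suc M\<close> and are split by Pascal's rule, as is the one in the
      goal.\<close>
    define M where "M = k + 2 * d + 1"
    have "nc_blocks (Suc (Suc k) + Suc d) (Suc (Suc k)) + nc_count (Suc (Suc k) + d) (Suc (Suc k)) =
        nc_blocks (Suc k + Suc d) (Suc k) + nc_count (Suc k + Suc d) (Suc k) +
        nc_blocks (Suc (Suc (Suc k)) + d) (Suc (Suc (Suc k)))"
      using nc_blocks_Suc[of "Suc k + Suc d" "Suc k"] by simp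
    moreover have "nc_blocks (Suc k + Suc d) (Suc k) = Suc k * (M choose Suc d)"
      using Suc by (simp add: M_def)
    moreover have "nc_blocks (Suc (Suc (Suc k)) + d) (Suc (Suc (Suc k))) = Suc (Suc (Suc k)) * (M choose d)"
      using outer[of "Suc (Suc k)"] by (simp add: M_def)
    moreover have "nc_count (Suc (Suc k) + d) (Suc (Suc k)) + (M choose (k + d + 2)) = M choose d"
      using nc_count_closed_form[of "Suc k" d] by (simp add: M_def)
    moreover have "nc_count (Suc k + Suc d) (Suc k) + ((M choose (k + d + 1)) + (M choose (k + d + 2))) =
        (M choose d) + (M choose Suc d)"
      using nc_count_closed_form[of k "Suc d"] by (simp add: M_def)
    \<comment> \<open>The coefficients \<open>M choose (k + d + 2)\<close> of the two counts cancel;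
      by symmetry the other unwanted coefficient is \<open>M choose d\<close> again.\<close>
    moreover have "M choose (k + d + 1) = M choose d"
    proof -
      have "d \<le> M" "M - d = k + d + 1" by (simp_all add: M_def)
      then show ?thesis using binomial_symmetric[of d M] by simp
    qed
    ultimately have "nc_blocks (Suc (Suc k) + Suc d) (Suc (Suc k)) = (k + 2) * ((M choose d) + (M choose Suc d))"
      by (simp add: add_mult_distrib add_mult_distrib2)
    then show ?case by (simp add: M_def)
  qed
qed

section \<open>Catalan totals: words, blocks and ascents\<close>

lemma card_nc_words: "card (nc_words n) + ((2 * n) choose (Suc n)) = (2 * n) choose n"
  \<comment> \<open>Every word of length \<open>n\<close> has exactly one continuation with a single
    open letter, so \<open>nc_count (Suc n) (Suc 0)\<close> is the total number of words.\<close>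
  using nc_count_closed_form[of 0 n] by (simp add: nc_count_Suc_eq_card)

text \<open>The two absorption identities make \<open>Suc n * ((2 * n) choose Suc n)\<close> equal
  to \<open>n * ((2 * n) choose n)\<close>; subtracting \<open>n * ((2 * n) choose Suc n)\<close>
  gives \<open>n\<close> times the Catalan number.\<close>

lemma mult_card_nc_words: "n * card (nc_words n) = (2 * n) choose (Suc n)"
proof -
  have "Suc n * ((2 * n) choose Suc n) = 2 * n * ((2 * n - 1) choose n)"
    by (rule binomial_absorption)
  also have "\<dots> = (2 * n - n) * ((2 * n) choose n)"
    by (rule binomial_absorb_comp[symmetric])
  finally have "Suc n * ((2 * n) choose Suc n) = n * ((2 * n) choose n)" by simp
  then have "n * card (nc_words n) + n * ((2 * n) choose Suc n) = Suc n * ((2 * n) choose Suc n)"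
    using card_nc_words[of n] by (metis distrib_left)
  then show ?thesis by simp
qed

text \<open>For \<open>n > 0\<close> every word has an open letter, so its continuation with a
  single open letter reuses an old letter and keeps the number of blocks. The sum is therefore
  \<open>nc_blocks (Suc n) (Suc 0)\<close>.\<close>

lemma sum_card_set_nc_words:
  assumes "n > 0"
  shows "(\<Sum>w\<in>nc_words n. card (set w)) = (2 * n - 1) choose n"
proof -
  have "card (open_letters w) \<noteq> 0" if "w \<in> nc_words n" for w
    using no_nc_words[of n 0] assms that by auto
  then have "nc_blocks (Suc n) (Suc 0) = (\<Sum>w\<in>nc_words n. card (set w))"
    unfolding nc_blocks_Suc_eq_sum by (intro sum.cong) auto
  then show ?thesis using nc_blocks_closed_form[of 0 n] by simp
qed

lemma Suc_ascents:
  assumes "w \<in> nc_words n" "w \<noteq> []"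
  shows "Suc (ascents w) = card (set w)"
  using assms
proof (induction w arbitrary: n rule: rev_induct)
  case (snoc a w)
  show ?case
  proof (cases "w = []")
    case True
    then show ?thesis by (simp add: ascents_def)
  next
    case False
    obtain n' where n': "n = Suc n'"
      using snoc.prems(1) by (cases n) (auto simp: nc_words_def)
    have w: "w \<in> nc_words n'" and a: "a \<in> next_letters w"
      using snoc.prems(1) unfolding n' nc_words_append by auto
    have "rgf w" using w by (simp add: nc_words_def)
    have last_in: "last w \<in> set w" using False by simp
    have asc: "last w < a \<longleftrightarrow> a \<notin> set w"
    proof (cases "a \<in> set w")
      case True
      have "a \<noteq> Suc (card (set w))" using next_letter_unused_iff[OF \<open>rgf w\<close> a] True by blast
      then have "a \<in> open_letters w" using a by (simp add: next_letters_def)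
      then obtain i where "i < length w" "\<forall>j < length w. i \<le> j \<longrightarrow> a \<le> w ! j"
        unfolding mem_open_letters_iff by blast
      then have "a \<le> last w" using False by (simp add: last_conv_nth)
      then show ?thesis using True by simp
    next
      case new: False
      then have "a = Suc (card (set w))" using next_letter_unused_iff[OF \<open>rgf w\<close> a] by blast
      then show ?thesis using new last_in mem_set_rgf_iff[OF \<open>rgf w\<close>, of "last w"] by simp
    qed
    define l where "l = length w - 1"
    have l: "length w = Suc l" "w ! l = last w"
      using False by (simp_all add: l_def last_conv_nth)
    have "{i. Suc i < length (w @ [a]) \<and> (w @ [a]) ! i < (w @ [a]) ! Suc i} =
        {i. Suc i < length w \<and> w ! i < w ! Suc i} \<union> (if last w < a then {l} else {})"
      (is "?A = ?B \<union> ?C")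
    proof (rule set_eqI)
      fix i
      consider "i < l" | "i = l" | "i > l" by linarith
      then show "i \<in> ?A \<longleftrightarrow> i \<in> ?B \<union> ?C"
        by cases (use l in \<open>simp_all add: nth_append\<close>)
    qed
    moreover have "card (?B \<union> ?C) = card ?B + card ?C"
      by (rule card_Un_disjoint) (use l in \<open>auto intro: finite_subset[of _ "{..<length w}"]\<close>)
    ultimately have "ascents (w @ [a]) = ascents w + (if last w < a then 1 else 0)"
      unfolding ascents_def by simp
    moreover have "card (set (w @ [a])) = card (set w) + (if a \<notin> set w then 1 else 0)"
      by (simp add: insert_absorb)
    ultimately show ?thesis using snoc.IH[OF w False] asc by simp
  qed
qed simp

text \<open>The total is the number of blocks minus the number of words. Halving the central
  binomial coefficient and applying Pascal's rule to \<open>(2 * n) choose Suc n\<close> brings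
  everything to top index \<open>2 * n - 1\<close>.\<close>

lemma sum_ascents_nc_words:
  assumes "n > 0"
  shows "(\<Sum>w\<in>nc_words n. ascents w) = (2 * n - 1) choose (Suc n)"
proof -
  have "(\<Sum>w\<in>nc_words n. card (set w)) = (\<Sum>w\<in>nc_words n. ascents w + 1)"
    by (rule sum.cong) (use Suc_ascents assms in \<open>fastforce simp: nc_words_def\<close>)+
  then have "(\<Sum>w\<in>nc_words n. ascents w) + card (nc_words n) = (2 * n - 1) choose n"
    using sum_card_set_nc_words[OF assms] unfolding sum.distrib by simp
  moreover obtain p where p: "n = Suc p" using assms by (cases n) auto
  moreover have "(2 * n) choose n = 2 * ((2 * n - 1) choose n)"
  proof -
    have "(2 * p + 1) choose p = (2 * p + 1) choose Suc p"
      using binomial_symmetric[of p "2 * p + 1"] by simp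
    then show ?thesis by (simp add: p)
  qed
  moreover have "(2 * n) choose Suc n = ((2 * n - 1) choose n) + ((2 * n - 1) choose Suc n)"
    by (simp add: p)
  ultimately show ?thesis using card_nc_words[of n] by linarith
qed

section \<open>Contracting a run of equal letters\<close>

text \<open>Reading \<open>w\<close> through a monotone surjection only repeats letters in place,
  which preserves the order of first occurrences and neither creates nor destroys crossings.\<close>

lemma nc_words_pullback:
  assumes mono: "\<And>p q. p \<le> q \<Longrightarrow> q < n \<Longrightarrow> f p \<le> f q" and onto: "f ` {..<n} = {..<r}"
    and len: "length w = r"
  shows "map (\<lambda>p. w ! f p) [0..<n] \<in> nc_words n \<longleftrightarrow> w \<in> nc_words r"
proof -
  let ?u = "map (\<lambda>p. w ! f p) [0..<n]"
  have u: "length ?u = n" "\<And>p. p < n \<Longrightarrow> ?u ! p = w ! f p" by simp_all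
  have bound: "f p < r" if "p < n" for p using onto that by blast
  have pre: "\<exists>p<n. f p = j" if "j < r" for j
  proof -
    have "j \<in> f ` {..<n}" using onto that by simp
    then show ?thesis by auto
  qed
  have less: "p < q" if "f p < f q" "p < n" "q < n" for p q
    using mono[of q p] that by (meson leD leI)
  have "rgf ?u \<longleftrightarrow> rgf w"
  proof
    assume R: "rgf ?u"
    show "rgf w"
      unfolding rgf_def len
    proof (intro allI impI conjI; (elim conjE)?)
      fix i assume "i < r"
      then obtain p where p: "p < n" "f p = i" using pre by blast
      then show "1 \<le> w ! i" using R u unfolding rgf_def by metis
      fix x assume x: "1 \<le> x" "x < w ! i"
      then obtain q where q: "q < p" "?u ! q = x" using R p u unfolding rgf_def by metis
      then have "w ! f q = x" using p by simp
      moreover have "f q \<noteq> f p" using calculation x p by auto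
      ultimately show "\<exists>j<i. w ! j = x" using mono[of q p] p q by (intro exI[of _ "f q"]) auto
    qed
  next
    assume R: "rgf w"
    show "rgf ?u"
      unfolding rgf_def u(1)
    proof (intro allI impI conjI; (elim conjE)?)
      fix p assume p: "p < n"
      then show "1 \<le> ?u ! p" using R bound[OF p] u(2) len unfolding rgf_def by metis
      fix x assume x: "1 \<le> x" "x < ?u ! p"
      then obtain j where j: "j < f p" "w ! j = x"
        using R bound[OF p] u(2)[OF p] len unfolding rgf_def by metis
      then obtain q where q: "q < n" "f q = j" using pre bound[OF p] by (meson less_trans)
      then show "\<exists>q<p. ?u ! q = x" using less[of q p] p j by (intro exI[of _ q]) simp
    qed
  qed
  moreover have "noncrossing ?u \<longleftrightarrow> noncrossing w"
  proof
    assume N: "noncrossing ?u"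
    show "noncrossing w"
      unfolding noncrossing_def len
    proof (intro notI, elim exE conjE)
      fix i j k l
      assume *: "i < j" "j < k" "k < l" "l < r" "w ! i = w ! k" "w ! j = w ! l" "w ! i < w ! j"
      obtain a where a: "a < n" "f a = i" using pre[of i] * by auto
      obtain b where b: "b < n" "f b = j" using pre[of j] * by auto
      obtain c where c: "c < n" "f c = k" using pre[of k] * by auto
      obtain d where d: "d < n" "f d = l" using pre[of l] * by auto
      have "a < b" "b < c" "c < d" using less a b c d * by simp_all
      then have "\<exists>i j k l. i < j \<and> j < k \<and> k < l \<and> l < length ?u \<and>
          ?u ! i = ?u ! k \<and> ?u ! j = ?u ! l \<and> ?u ! i < ?u ! j"
        using a b c d * by (intro exI[of _ a] exI[of _ b] exI[of _ c] exI[of _ d]) simp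
      then show False using N unfolding noncrossing_def by blast
    qed
  next
    assume N: "noncrossing w"
    show "noncrossing ?u"
      unfolding noncrossing_def u(1)
    proof (intro notI, elim exE conjE)
      fix i j k l
      assume *: "i < j" "j < k" "k < l" "l < n" "?u ! i = ?u ! k" "?u ! j = ?u ! l" "?u ! i < ?u ! j"
      then have v: "w ! f i = w ! f k" "w ! f j = w ! f l" "w ! f i < w ! f j" by simp_all
      have "f i \<le> f j" "f j \<le> f k" "f k \<le> f l" "f l < r" using * mono bound by simp_all
      \<comment> \<open>Neighbouring letters of a crossing differ, so \<open>f\<close> cannot merge
        their positions.\<close>
      moreover have "f i \<noteq> f j" "f j \<noteq> f k" "f k \<noteq> f l" using v by auto
      ultimately have "f i < f j" "f j < f k" "f k < f l" "f l < length w" using len by simp_all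
      then show False using N v unfolding noncrossing_def by blast
    qed
  qed
  ultimately show ?thesis using len by (simp add: nc_words_def)
qed

text \<open>For \<open>1 \<le> m\<close>, truncated subtraction makes the second summand 0 up to the
  end \<open>i + m - 1\<close> of the run. Thus the whole run goes to \<open>i\<close>, and later
  positions move left by \<open>m - 1\<close>.\<close>

definition collapse :: "nat \<Rightarrow> nat \<Rightarrow> nat \<Rightarrow> nat" where
  "collapse i m p = min p i + (p - (i + m - 1))"

text \<open>A right inverse of \<open>collapse\<close> that selects the first position of the
  run.\<close>

definition stretch :: "nat \<Rightarrow> nat \<Rightarrow> nat \<Rightarrow> nat" where
  "stretch i m j = (if j \<le> i then j else j + (m - 1))"

lemma collapse_stretch: "1 \<le> m \<Longrightarrow> collapse i m (stretch i m j) = j"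
  by (auto simp: collapse_def stretch_def)

lemma stretch_collapse:
  "1 \<le> m \<Longrightarrow> stretch i m (collapse i m p) = (if i \<le> p \<and> p < i + m then i else p)"
  by (auto simp: collapse_def stretch_def)

text \<open>The map expands letter \<open>i\<close> into \<open>m\<close> copies; its inverse reads
  a word at the positions given by \<open>stretch\<close>. Since \<open>collapse\<close> is monotone
  and onto, \<open>nc_words_pullback\<close> transfers membership in both directions.\<close>

lemma bij_betw_contract_run:
  assumes m: "1 \<le> m" and i: "i + m \<le> n" and r: "r = n - m + 1"
  shows "bij_betw (\<lambda>w. map (\<lambda>p. w ! collapse i m p) [0..<n]) (nc_words r)
           {u \<in> nc_words n. \<forall>j<m. u ! (i + j) = u ! i}"
proof -
  let ?c = "collapse i m" and ?s = "stretch i m"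
  have ir: "i < r" using m i r by linarith
  have cb: "?c p < r" if "p < n" for p using that m i r by (auto simp: collapse_def)
  have sb: "?s j < n" if "j < r" for j using that m i r by (auto simp: stretch_def)
  have "?c ` {..<n} = {..<r}"
  proof
    show "{..<r} \<subseteq> ?c ` {..<n}"
      using collapse_stretch[OF m] sb by (metis image_eqI lessThan_iff subsetI)
  qed (use cb in auto)
  moreover have "?c p \<le> ?c q" if "p \<le> q" for p q
    using that by (auto simp: collapse_def intro: add_mono)
  ultimately have mem: "map (\<lambda>p. w ! ?c p) [0..<n] \<in> nc_words n \<longleftrightarrow> w \<in> nc_words r"
    if "length w = r" for w
    using that by (intro nc_words_pullback)
  have run: "?c (i + j) = i" if "j < m" for j using that by (simp add: collapse_def)
  show ?thesis
  proof (rule bij_betw_byWitness[where f' = "\<lambda>u. map (\<lambda>j. u ! ?s j) [0..<r]"])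
    show "\<forall>w\<in>nc_words r. map (\<lambda>j. map (\<lambda>p. w ! ?c p) [0..<n] ! ?s j) [0..<r] = w"
      by (auto intro!: nth_equalityI simp: nc_words_def sb collapse_stretch[OF m])
    have restore: "map (\<lambda>p. map (\<lambda>j. u ! ?s j) [0..<r] ! ?c p) [0..<n] = u"
      if u: "length u = n" "\<forall>j<m. u ! (i + j) = u ! i" for u
    proof (rule nth_equalityI)
      fix p assume "p < length (map (\<lambda>p. map (\<lambda>j. u ! ?s j) [0..<r] ! ?c p) [0..<n])"
      then have p: "p < n" by simp
      have "u ! p = u ! i" if "i \<le> p" "p < i + m"
        using u(2)[rule_format, of "p - i"] that by simp
      then show "map (\<lambda>p. map (\<lambda>j. u ! ?s j) [0..<r] ! ?c p) [0..<n] ! p = u ! p"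
        using p cb[OF p] by (simp add: stretch_collapse[OF m])
    qed (use u in simp)
    then show "\<forall>u\<in>{u \<in> nc_words n. \<forall>j<m. u ! (i + j) = u ! i}.
        map (\<lambda>p. map (\<lambda>j. u ! ?s j) [0..<r] ! ?c p) [0..<n] = u"
      by (intro ballI restore) (auto simp: nc_words_def)
    show "(\<lambda>w. map (\<lambda>p. w ! ?c p) [0..<n]) ` nc_words r \<subseteq>
        {u \<in> nc_words n. \<forall>j<m. u ! (i + j) = u ! i}"
    proof clarify
      fix w assume w: "w \<in> nc_words r"
      then have "map (\<lambda>p. w ! ?c p) [0..<n] \<in> nc_words n" using mem by (simp add: nc_words_def)
      moreover have "?c i = i" using run[of 0] m by simp
      ultimately show "map (\<lambda>p. w ! ?c p) [0..<n] \<in> nc_words n \<and>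
          (\<forall>j<m. map (\<lambda>p. w ! ?c p) [0..<n] ! (i + j) = map (\<lambda>p. w ! ?c p) [0..<n] ! i)"
        using run i m by auto
    qed
    show "(\<lambda>u. map (\<lambda>j. u ! ?s j) [0..<r]) ` {u \<in> nc_words n. \<forall>j<m. u ! (i + j) = u ! i} \<subseteq> nc_words r"
    proof clarify
      fix u assume u: "u \<in> nc_words n" "\<forall>j<m. u ! (i + j) = u ! i"
      then have "length u = n" by (simp add: nc_words_def)
      \<comment> \<open>By \<open>restore\<close> the contracted word expands to \<open>u\<close>
        again, so \<open>mem\<close> carries membership of \<open>u\<close> back to it.\<close>
      then show "map (\<lambda>j. u ! ?s j) [0..<r] \<in> nc_words r"
        using mem[of "map (\<lambda>j. u ! ?s j) [0..<r]"] restore[of u] u by simp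
    qed
  qed
qed

lemma card_run:
  assumes "1 \<le> m" "i + m \<le> n"
  shows "card {u \<in> nc_words n. \<forall>j<m. u ! (i + j) = u ! i} = card (nc_words (n - m + 1))"
  using bij_betw_same_card[OF bij_betw_contract_run[OF assms refl]] by simp

text \<open>Contraction sends position \<open>i + m\<close> to \<open>Suc i\<close>, so the step
  leaving the run becomes a step between neighbours.\<close>

lemma card_run_ascent:
  assumes m: "1 \<le> m" and i: "i + Suc m \<le> n"
  shows "card {u \<in> nc_words n. (\<forall>j<m. u ! (i + j) = u ! i) \<and> u ! i < u ! (i + m)} =
    card {w \<in> nc_words (n - m + 1). w ! i < w ! Suc i}"
proof -
  let ?g = "\<lambda>w. map (\<lambda>p. w ! collapse i m p) [0..<n]"
  have bij: "bij_betw ?g (nc_words (n - m + 1)) {u \<in> nc_words n. \<forall>j<m. u ! (i + j) = u ! i}"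
    by (rule bij_betw_contract_run) (use m i in auto)
  have "collapse i m i = i" "collapse i m (i + m) = Suc i" using m by (auto simp: collapse_def)
  then have "?g w ! i < ?g w ! (i + m) \<longleftrightarrow> w ! i < w ! Suc i" for w using i by simp
  then have "?g ` {w \<in> nc_words (n - m + 1). w ! i < w ! Suc i} =
      {u \<in> {u \<in> nc_words n. \<forall>j<m. u ! (i + j) = u ! i}. u ! i < u ! (i + m)}"
    unfolding bij_betw_imp_surj_on[OF bij, symmetric] by blast
  then have "bij_betw ?g {w \<in> nc_words (n - m + 1). w ! i < w ! Suc i}
      {u \<in> nc_words n. (\<forall>j<m. u ! (i + j) = u ! i) \<and> u ! i < u ! (i + m)}"
    by (intro bij_betw_subset[OF bij]) auto
  then show ?thesis by (rule bij_betw_same_card[symmetric])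
qed

section \<open>Occurrences of the two patterns and their totals\<close>

lemma occurrences_replicate:
  assumes "1 \<le> m" "m \<le> length w"
  shows "occurrences (replicate m 1) w =
    card {i \<in> {..<length w - m + 1}. \<forall>j<m. w ! (i + j) = w ! i}"
proof -
  have "order_isomorphic (take m (drop i w)) (replicate m 1) \<longleftrightarrow> (\<forall>j<m. w ! (i + j) = w ! i)"
    if "i + m \<le> length w" for i
  proof -
    have "order_isomorphic (take m (drop i w)) (replicate m 1) \<longleftrightarrow>
        (\<forall>a<m. \<forall>b<m. \<not> w ! (i + a) < w ! (i + b) \<and> w ! (i + a) = w ! (i + b))"
      unfolding order_isomorphic_def using that by simp
    also have "\<dots> \<longleftrightarrow> (\<forall>j<m. w ! (i + j) = w ! i)"
    proof
      assume A: "\<forall>a<m. \<forall>b<m. \<not> w ! (i + a) < w ! (i + b) \<and> w ! (i + a) = w ! (i + b)"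
      have "w ! (i + j) = w ! (i + 0)" if "j < m" for j
        using A[rule_format, of j 0] that assms by blast
      then show "\<forall>j<m. w ! (i + j) = w ! i" by simp
    qed simp
    finally show ?thesis .
  qed
  moreover have "i + m \<le> length w \<longleftrightarrow> i < length w - m + 1" for i using assms by linarith
  ultimately have "{i. i + m \<le> length w \<and> order_isomorphic (take m (drop i w)) (replicate m 1)} =
      {i \<in> {..<length w - m + 1}. \<forall>j<m. w ! (i + j) = w ! i}" by auto
  then show ?thesis by (simp add: occurrences_def)
qed

lemma occurrences_replicate_2:
  assumes "1 \<le> m" "m \<le> length w"
  shows "occurrences (replicate m 1 @ [2]) w =
    card {i \<in> {..<length w - m}. (\<forall>j<m. w ! (i + j) = w ! i) \<and> w ! i < w ! (i + m)}"
proof -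
  let ?t = "replicate m 1 @ [2] :: nat list"
  have "order_isomorphic (take (Suc m) (drop i w)) ?t \<longleftrightarrow>
      (\<forall>j<m. w ! (i + j) = w ! i) \<and> w ! i < w ! (i + m)" (is "?L \<longleftrightarrow> ?R")
    if i: "i + Suc m \<le> length w" for i
  proof -
    have t: "?t ! a = (if a < m then 1 else 2)" if "a < Suc m" for a
      using that by (auto simp: nth_append less_Suc_eq)
    have "?L \<longleftrightarrow> (\<forall>a<Suc m. \<forall>b<Suc m. (w ! (i + a) < w ! (i + b) \<longleftrightarrow> ?t ! a < ?t ! b) \<and>
        (w ! (i + a) = w ! (i + b) \<longleftrightarrow> ?t ! a = ?t ! b))"
      unfolding order_isomorphic_def using i by auto
    also have "\<dots> \<longleftrightarrow> ?R"
    proof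
      assume A: "\<forall>a<Suc m. \<forall>b<Suc m. (w ! (i + a) < w ! (i + b) \<longleftrightarrow> ?t ! a < ?t ! b) \<and>
        (w ! (i + a) = w ! (i + b) \<longleftrightarrow> ?t ! a = ?t ! b)"
      have "w ! (i + j) = w ! (i + 0)" if "j < m" for j
        using A[rule_format, of j 0] that assms t[of j] t[of 0] by simp
      moreover have "w ! (i + 0) < w ! (i + m)"
        using A[rule_format, of 0 m] assms t[of m] t[of 0] by simp
      ultimately show ?R by simp
    next
      assume R: ?R
      then have W: "w ! (i + a) = (if a < m then w ! i else w ! (i + m))" if "a < Suc m" for a
        using that by (auto simp: less_Suc_eq)
      have less: "w ! i < w ! (i + m)" using R by blast
      show "\<forall>a<Suc m. \<forall>b<Suc m. (w ! (i + a) < w ! (i + b) \<longleftrightarrow> ?t ! a < ?t ! b) \<and>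
        (w ! (i + a) = w ! (i + b) \<longleftrightarrow> ?t ! a = ?t ! b)"
      proof (intro allI impI)
        fix a b assume "a < Suc m" "b < Suc m"
        then show "(w ! (i + a) < w ! (i + b) \<longleftrightarrow> ?t ! a < ?t ! b) \<and>
          (w ! (i + a) = w ! (i + b) \<longleftrightarrow> ?t ! a = ?t ! b)"
          unfolding W[OF \<open>a < Suc m\<close>] W[OF \<open>b < Suc m\<close>] t[OF \<open>a < Suc m\<close>] t[OF \<open>b < Suc m\<close>]
          using less by simp
      qed
    qed
    finally show ?thesis .
  qed
  \<comment> \<open>The pattern has length \<open>m + 1\<close>, which leaves one starting position
    fewer than for \<open>1^m\<close>.\<close>
  moreover have "i + Suc m \<le> length w \<longleftrightarrow> i < length w - m" for i using assms by linarith
  ultimately have "{i. i + Suc m \<le> length w \<and> order_isomorphic (take (Suc m) (drop i w)) ?t} =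
      {i \<in> {..<length w - m}. (\<forall>j<m. w ! (i + j) = w ! i) \<and> w ! i < w ! (i + m)}" by auto
  then show ?thesis by (simp add: occurrences_def)
qed

text \<open>Counting pairs of a word and a position by position, each of the \<open>r\<close>
  positions contributes \<open>card (nc_words r)\<close>.\<close>

lemma sum_occurrences_replicate:
  assumes "1 \<le> m" "m \<le> n" "r = n - m + 1"
  shows "(\<Sum>w\<in>nc_words n. occurrences (replicate m 1) w) = (2 * r) choose (r + 1)"
proof -
  have "(\<Sum>w\<in>nc_words n. occurrences (replicate m 1) w) =
      (\<Sum>w\<in>nc_words n. card {i \<in> {..<r}. \<forall>j<m. w ! (i + j) = w ! i})"
    by (rule sum.cong) (use assms in \<open>simp_all add: nc_words_def occurrences_replicate[unfolded One_nat_def]\<close>)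
  also have "\<dots> = (\<Sum>i<r. card (nc_words r))"
    by (rule sum_multicount_gen) (use assms in \<open>auto simp: finite_nc_words card_run\<close>)
  finally show ?thesis using mult_card_nc_words[of r] by simp
qed

lemma sum_occurrences_replicate_2:
  assumes "1 \<le> m" "m \<le> n" "r = n - m + 1"
  shows "(\<Sum>w\<in>nc_words n. occurrences (replicate m 1 @ [2]) w) = (2 * r - 1) choose (r + 1)"
proof -
  have "(\<Sum>w\<in>nc_words n. occurrences (replicate m 1 @ [2]) w) =
      (\<Sum>w\<in>nc_words n. card {i \<in> {..<n - m}. (\<forall>j<m. w ! (i + j) = w ! i) \<and> w ! i < w ! (i + m)})"
    by (rule sum.cong) (use assms in \<open>simp_all add: nc_words_def occurrences_replicate_2[unfolded One_nat_def]\<close>)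
  also have "\<dots> = (\<Sum>i<n - m. card {w \<in> nc_words r. w ! i < w ! Suc i})"
    by (rule sum_multicount_gen) (use assms in \<open>auto simp: finite_nc_words card_run_ascent\<close>)
  \<comment> \<open>The sums are exchanged back: the \<open>n - m = r - 1\<close> positions are all
    the places for an ascent in a word of length \<open>r\<close>.\<close>
  also have "\<dots> = (\<Sum>w\<in>nc_words r. card {i \<in> {..<n - m}. w ! i < w ! Suc i})"
    by (rule sum_multicount_gen[symmetric]) (auto simp: finite_nc_words)
  also have "\<dots> = (\<Sum>w\<in>nc_words r. ascents w)"
  proof (rule sum.cong)
    fix w assume "w \<in> nc_words r"
    then have "Suc i < length w \<longleftrightarrow> i < n - m" for i using assms by (auto simp: nc_words_def)
    then show "card {i \<in> {..<n - m}. w ! i < w ! Suc i} = ascents w"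
      by (simp add: ascents_def)
  qed simp
  finally show ?thesis using sum_ascents_nc_words[of r] assms by simp
qed

section \<open>Canonical forms as a bijection from non-crossing partitions to words\<close>

lemma canonical_form_nth:
  "i < n \<Longrightarrow> canonical_form n P ! i = block_index P (block_of P (Suc i))"
  by (simp add: canonical_form_def del: upt_Suc)

lemma length_canonical_form: "length (canonical_form n P) = n"
  by (simp add: canonical_form_def)

lemma block_of_in_partition:
  assumes "partition_on A P" "i \<in> A"
  shows "block_of P i \<in> P" "i \<in> block_of P i"
proof -
  obtain B where "B \<in> P" "i \<in> B" using assms partition_onD1 by blast
  then show "block_of P i \<in> P" "i \<in> block_of P i" using block_of_eq[OF assms(1)] by auto
qed

lemma finite_block: "partition_on {1..n::nat} P \<Longrightarrow> B \<in> P \<Longrightarrow> finite B"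
  using partition_onD1 finite_subset by (metis Union_upper finite_atLeastAtMost)

lemma finite_partition: "partition_on {1..n::nat} P \<Longrightarrow> finite P"
  by (rule finite_elements) auto

lemma Min_in_block: "partition_on {1..n::nat} P \<Longrightarrow> B \<in> P \<Longrightarrow> Min B \<in> B"
  using finite_block partition_onD3 by (metis Min_in)

lemma inj_on_Min_blocks:
  assumes "partition_on {1..n::nat} P"
  shows "inj_on Min P"
  using Min_in_block[OF assms] block_of_eq[OF assms] by (metis inj_onI)

lemma bij_betw_block_index:
  assumes "partition_on {1..n} P"
  shows "bij_betw (block_index P) P {1..card P}"
  using bij_betw_rank[OF finite_partition[OF assms] inj_on_Min_blocks[OF assms]]
  unfolding block_index_def .

lemma block_index_mono:
  assumes "finite P" "Min B \<le> Min C"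
  shows "block_index P B \<le> block_index P C"
  unfolding block_index_def by (rule card_mono) (use assms in auto)

text \<open>A block \<open>C\<close> with smaller index has a smaller minimum than the block of
  \<open>Suc i\<close>, so its letter occurs before position \<open>i\<close>, namely at the
  position of \<open>Min C\<close>.\<close>

lemma rgf_canonical_form:
  assumes P: "partition_on {1..n} P"
  shows "rgf (canonical_form n P)"
  unfolding rgf_def length_canonical_form
proof (intro allI impI conjI; (elim conjE)?)
  fix i assume i: "i < n"
  let ?B = "block_of P (Suc i)"
  have B: "?B \<in> P" "Suc i \<in> ?B" using block_of_in_partition[OF P, of "Suc i"] i by auto
  have idx: "block_index P ?B \<in> {1..card P}" by (rule bij_betw_apply[OF bij_betw_block_index[OF P] B(1)])
  then show "1 \<le> canonical_form n P ! i" using i by (simp add: canonical_form_nth)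
  fix x assume x: "1 \<le> x" "x < canonical_form n P ! i"
  then have "x \<in> block_index P ` P"
    unfolding bij_betw_imp_surj_on[OF bij_betw_block_index[OF P]] using idx i
    by (simp add: canonical_form_nth)
  then obtain C where C: "C \<in> P" "block_index P C = x" by auto
  have "Min C < Min ?B"
  proof (rule ccontr)
    assume "\<not> Min C < Min ?B"
    then have "block_index P ?B \<le> block_index P C"
      by (intro block_index_mono finite_partition[OF P]) simp
    then show False using x C i by (simp add: canonical_form_nth)
  qed
  also have "Min ?B \<le> Suc i" using B finite_block[OF P B(1)] by simp
  finally have less: "Min C < Suc i" .
  have "Min C \<in> {1..n}" using Min_in_block[OF P C(1)] C(1) partition_onD1[OF P] by blast
  then obtain j where j: "Min C = Suc j" by (cases "Min C") auto
  then have "canonical_form n P ! j = x"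
    using less i C block_of_eq[OF P C(1) Min_in_block[OF P C(1)]] by (simp add: canonical_form_nth)
  then show "\<exists>j<i. canonical_form n P ! j = x" using less j by auto
qed

lemma canonical_form_eq_iff:
  assumes P: "partition_on {1..n} P" and ij: "i < n" "j < n"
  shows "canonical_form n P ! i = canonical_form n P ! j \<longleftrightarrow> Suc j \<in> block_of P (Suc i)"
proof -
  have i: "block_of P (Suc i) \<in> P" "Suc i \<in> block_of P (Suc i)"
    and j: "block_of P (Suc j) \<in> P" "Suc j \<in> block_of P (Suc j)"
    using block_of_in_partition[OF P] ij by auto
  have "canonical_form n P ! i = canonical_form n P ! j \<longleftrightarrow> block_of P (Suc i) = block_of P (Suc j)"
    using inj_on_eq_iff[OF bij_betw_imp_inj_on[OF bij_betw_block_index[OF P]] i(1) j(1)] ij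
    by (simp add: canonical_form_nth)
  also have "\<dots> \<longleftrightarrow> Suc j \<in> block_of P (Suc i)"
    using block_of_eq[OF P i(1)] j(2) by auto
  finally show ?thesis .
qed

text \<open>The right-hand side depends on \<open>P\<close> only through its word, which makes
  \<open>canonical_form\<close> injective; \<open>Suc\<close> converts list positions to
  elements.\<close>

lemma partition_eq_canonical_form:
  assumes P: "partition_on {1..n} P"
  shows "P = (\<lambda>i. Suc ` {j. j < n \<and> canonical_form n P ! i = canonical_form n P ! j}) ` {..<n}"
proof -
  have blk: "Suc ` {j. j < n \<and> canonical_form n P ! i = canonical_form n P ! j} = block_of P (Suc i)"
    if i: "i < n" for i
  proof -
    have "block_of P (Suc i) \<in> P" using block_of_in_partition[OF P] i by auto
    then have sub: "block_of P (Suc i) \<subseteq> {1..n}" using partition_onD1[OF P] by blast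
    have "{j. j < n \<and> canonical_form n P ! i = canonical_form n P ! j} =
        {j. j < n \<and> Suc j \<in> block_of P (Suc i)}"
      using canonical_form_eq_iff[OF P i] by blast
    moreover have "x \<in> Suc ` {j. j < n \<and> Suc j \<in> block_of P (Suc i)}"
      if x: "x \<in> block_of P (Suc i)" for x
    proof -
      have "x \<in> {1..n}" using sub x by blast
      then have "x = Suc (x - 1)" "x - 1 < n" by auto
      then show ?thesis using x by (metis (mono_tags, lifting) imageI mem_Collect_eq)
    qed
    ultimately show ?thesis by auto
  qed
  have "(\<lambda>i. block_of P (Suc i)) ` {..<n} = P"
  proof
    show "(\<lambda>i. block_of P (Suc i)) ` {..<n} \<subseteq> P"
      using block_of_in_partition[OF P] by auto
    show "P \<subseteq> (\<lambda>i. block_of P (Suc i)) ` {..<n}"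
    proof
      fix B assume B: "B \<in> P"
      have Min: "Min B \<in> B" by (rule Min_in_block[OF P B])
      then have "Min B \<in> {1..n}" using B partition_onD1[OF P] by blast
      then have "Min B = Suc (Min B - 1)" "Min B - 1 < n" by auto
      then show "B \<in> (\<lambda>i. block_of P (Suc i)) ` {..<n}"
        using block_of_eq[OF P B Min] by (metis imageI lessThan_iff)
    qed
  qed
  then show ?thesis using blk by simp
qed

text \<open>The blocks are the position sets of the letters. Restricted growth makes their minima
  increase with the letter, so \<open>block_index_ordered\<close> returns each letter as the index
  of its block.\<close>

lemma canonical_form_surj:
  assumes "rgf w"
  shows "\<exists>P. partition_on {1..length w} P \<and> canonical_form (length w) P = w"
proof -
  define n k where "n = length w" and "k = card (set w)"
  define B where "B x = {i \<in> {1..n}. w ! (i - 1) = x}" for x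
  define P where "P = B ` {1..k}"
  have mem: "x \<in> set w \<longleftrightarrow> 1 \<le> x \<and> x \<le> k" for x
    unfolding k_def by (rule mem_set_rgf_iff[OF assms])
  have letter: "w ! (i - 1) \<in> {1..k}" if "i \<in> {1..n}" for i
    using mem[of "w ! (i - 1)"] that by (auto simp: n_def)
  have ne: "B x \<noteq> {}" if "x \<in> {1..k}" for x
  proof -
    have "x \<in> set w" using mem that by simp
    then obtain i where "i < n" "w ! i = x" by (auto simp: in_set_conv_nth n_def)
    then have "Suc i \<in> B x" by (simp add: B_def)
    then show ?thesis by blast
  qed
  have fin: "finite (B x)" for x by (simp add: B_def)
  have part: "partition_on {1..n} P"
  proof (rule partition_onI)
    show "\<Union>P = {1..n}" using letter unfolding P_def B_def by auto
    show "\<And>p q. p \<in> P \<Longrightarrow> q \<in> P \<Longrightarrow> p \<noteq> q \<Longrightarrow> disjnt p q"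
      unfolding P_def B_def disjnt_def by auto
    show "{} \<notin> P" using ne unfolding P_def by force
  qed
  have mono: "Min (B x) < Min (B y)" if xy: "1 \<le> x" "x < y" "y \<le> k" for x y
  proof -
    have "Min (B y) \<in> B y" using Min_in[OF fin ne] xy by simp
    then have y: "Min (B y) \<in> {1..n}" "w ! (Min (B y) - 1) = y" by (auto simp: B_def)
    \<comment> \<open>Restricted growth is applied at the first occurrence of \<open>y\<close>,
      whose list position is \<open>Min (B y) - 1\<close>.\<close>
    then obtain j where "j < Min (B y) - 1" "w ! j = x"
      using assms xy unfolding rgf_def n_def
      by (metis Suc_le_eq Suc_pred' atLeastAtMost_iff le_zero_eq not_gr_zero not_one_le_zero)
    then have "Suc j \<in> B x" "Suc j < Min (B y)" using y by (auto simp: B_def)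
    then show ?thesis using Min_le[OF fin] by (meson le_less_trans)
  qed
  have "canonical_form n P ! i = w ! i" if i: "i < n" for i
  proof -
    have x: "w ! i \<in> {1..k}" using letter[of "Suc i"] i by simp
    have "B (w ! i) \<in> P" "Suc i \<in> B (w ! i)" using x i by (simp_all add: P_def B_def)
    then have "block_of P (Suc i) = B (w ! i)" by (rule block_of_eq[OF part])
    moreover have "block_index P (B (w ! i)) = w ! i"
      by (rule block_index_ordered[OF P_def mono]) (use x in auto)
    ultimately show ?thesis using i by (simp add: canonical_form_nth)
  qed
  then have "canonical_form n P = w"
    by (intro nth_equalityI) (auto simp: length_canonical_form n_def)
  then show ?thesis using part unfolding n_def by blast
qed

lemma bij_betw_canonical_form: "bij_betw (canonical_form n) (NC n) (nc_words n)"
proof (rule bij_betw_imageI)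
  show "inj_on (canonical_form n) (NC n)"
  proof (rule inj_onI)
    fix P Q assume "P \<in> NC n" "Q \<in> NC n" "canonical_form n P = canonical_form n Q"
    then show "P = Q"
      using partition_eq_canonical_form[of n P] partition_eq_canonical_form[of n Q] by (simp add: NC_def)
  qed
  show "canonical_form n ` NC n = nc_words n"
  proof
    show "canonical_form n ` NC n \<subseteq> nc_words n"
      by (auto simp: NC_def nc_words_def rgf_canonical_form length_canonical_form)
    show "nc_words n \<subseteq> canonical_form n ` NC n"
    proof
      fix w assume "w \<in> nc_words n"
      then have w: "rgf w" "length w = n" "noncrossing w" by (auto simp: nc_words_def)
      then obtain P where "partition_on {1..n} P" "canonical_form n P = w"
        using canonical_form_surj by blast
      then show "w \<in> canonical_form n ` NC n" using w by (auto simp: NC_def)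
    qed
  qed
qed

theorem corollary3:
  fixes n m r :: nat
  assumes "1 \<le> m" and "m \<le> n" and "r = n - m + 1"
  shows "(\<Sum>P\<in>NC n. occurrences (replicate m 1) (canonical_form n P)) = (2 * r) choose (r + 1)
       \<and> (\<Sum>P\<in>NC n. occurrences (replicate m 1 @ [2]) (canonical_form n P)) = (2 * r - 1) choose (r + 1)"
  unfolding sum.reindex_bij_betw[OF bij_betw_canonical_form]
  using sum_occurrences_replicate[OF assms] sum_occurrences_replicate_2[OF assms] by blast

end
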